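(* Suppose $1\ll k\ll n$. Then, for any positive constant $\alpha$, $$\mathbb{P}\big[\mathrm{comp}_{\min}(\mathbf{C}_{n,p})>k\big]\sim\begin{cases}0,&\text{if } q\gg 1/\sqrt{kn},\\ e^{-\alpha^2},&\text{if } q\sim\alpha/\sqrt{kn},\\ 1,&\text{if } 1/\sqrt{kn}\gg q,\end{cases}$$ and $$\mathbb{P}\big[\mathrm{gap}_{\min}(\mathbf{C}_{n,p})>k\big]\sim\begin{cases}1,&\text{if } p\ll 1/\sqrt{kn},\\ e^{-\alpha^2},&\text{if } p\sim\alpha/\sqrt{kn},\\ 0,&\text{if } 1/\sqrt{kn}\ll p.\end{cases}$$
   Context: Here $k=k(n)$ may depend on $n$. An $n$-composition is a sequence of $n$ nonnegative integers. For $p=p(n)\in[0,1)$ and $q=1-p$, the geometric random composition $\mathbf{C}_{n,p}$ is the random $n$-composition whose terms are independent, with $\mathbb{P}[\mathbf{C}_{n,p}(i)=j]=qp^j$ for every $j\ge0$ and $i\in\{1,\dots,n\}$, where $\mathbf{C}_{n,p}(i)$ denotes the $i$th term. A component of a composition is a maximal run of (consecutive) nonzero terms; a gap is a maximal run of (consecutive) zero terms. For a composition $C$, $\mathrm{comp}_{\min}(C)$ is the length of the shortest component of $C$, and $\mathrm{gap}_{\min}(C)$ is the length of the shortest gap in $C$. For positive functions $f,g$ of $n$: $f\ll g$ (or $g\gg f$) means $\lim_{n\to\infty} f/g=0$ (in particular, $1\ll k$ means $k\to\infty$), and $f\sim g$ means $\lim_{n\to\infty} f/g=1$; also, $f\sim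 0$ means $\lim_{n\to\infty} f=0$. *)

theory Defs
  imports "HOL-Probability.Probability" "HOL-Probability.Product_PMF"
    "HOL-Library.Landau_Symbols"
begin

text \<open>
  An \<open>n\<close>-composition is given by a function \<open>C :: nat \<Rightarrow> nat\<close> together with \<open>n\<close>; its terms are
  \<open>C 1, \<dots>, C n\<close>, and all values of \<open>C\<close> outside \<open>{1..n}\<close> are ignored.
\<close>

text \<open>
  \<open>geometric_pmf q\<close> gives mass \<open>(1 - q) ^ j * q\<close> to \<open>j\<close> if \<open>0 < q \<le> 1\<close>, hence \<open>q * p ^ j\<close>
  for \<open>q = 1 - p\<close>; \<open>Pi_pmf\<close> makes the terms independent.
\<close>

definition random_composition :: "nat \<Rightarrow> real \<Rightarrow> (nat \<Rightarrow> nat) pmf" where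
  "random_composition n p = Pi_pmf {1..n} 0 (\<lambda>_. geometric_pmf (1 - p))"

definition is_run :: "(nat \<Rightarrow> bool) \<Rightarrow> nat \<Rightarrow> (nat \<Rightarrow> nat) \<Rightarrow> nat set \<Rightarrow> bool" where
  "is_run P n C I \<longleftrightarrow>
     (\<exists>a b. 1 \<le> a \<and> a \<le> b \<and> b \<le> n \<and> I = {a..b}) \<and> (\<forall>i\<in>I. P (C i))"

definition is_maximal_run :: "(nat \<Rightarrow> bool) \<Rightarrow> nat \<Rightarrow> (nat \<Rightarrow> nat) \<Rightarrow> nat set \<Rightarrow> bool" where
  "is_maximal_run P n C I \<longleftrightarrow> is_run P n C I \<and> (\<forall>J. is_run P n C J \<and> I \<subseteq> J \<longrightarrow> J = I)"

definition components :: "nat \<Rightarrow> (nat \<Rightarrow> nat) \<Rightarrow> nat set set" where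
  "components n C = {I. is_maximal_run (\<lambda>x. x \<noteq> 0) n C I}"

definition gaps :: "nat \<Rightarrow> (nat \<Rightarrow> nat) \<Rightarrow> nat set set" where
  "gaps n C = {I. is_maximal_run (\<lambda>x. x = 0) n C I}"

text \<open>
  A composition without components (or without gaps) has no shortest one; the value is then
  taken to be \<open>0\<close>, so that \<open>comp_min n C > k\<close> with \<open>k \<ge> 0\<close> entails that a component exists.
  The value \<open>\<infinity>\<close> would not do: for \<open>p = 0\<close> there are almost surely no components, and yet
  the probability that the shortest component is longer than \<open>k\<close> has to vanish.
\<close>

definition comp_min :: "nat \<Rightarrow> (nat \<Rightarrow> nat) \<Rightarrow> nat" where
  "comp_min n C = (if components n C = {} then 0 else Min (card ` components n C))"

definition gap_min :: "nat \<Rightarrow> (nat \<Rightarrow> nat) \<Rightarrow> nat" where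
  "gap_min n C = (if gaps n C = {} then 0 else Min (card ` gaps n C))"

text \<open>
  For positive functions the relation \<open>f \<ll> g\<close>, i.e. \<open>f n / g n \<longlonglongrightarrow> 0\<close>, is rendered as \<open>f \<in> o(g)\<close>.
  The latter is the right notion also when \<open>g\<close> has zeros: \<open>f n / g n\<close> is \<open>0\<close> by convention if \<open>g n = 0\<close>,
  whereas \<open>f \<in> o(g)\<close> forces \<open>f n = 0\<close> at such \<open>n\<close> from some point on.
\<close>

end

theory Submission imports Defs begin

text \<open>
  Call a position a break if its term is zero (for components) or nonzero (for gaps). Then
  components and gaps are the maximal runs of non-breaks, the breaks are independent, and each has
  probability \<open>r = q\<close> or \<open>r = p\<close>. Both halves of the theorem are therefore one statement about \<open>n\<close>
  independent coins: it concerns the event that there is a run of non-breaks and that every such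
  run is longer than \<open>K = \<lfloor>k\<rfloor>\<close>.

  Away from the ends of the sequence, a run of length between \<open>1\<close> and \<open>K\<close> lies between two breaks
  at distance at most \<open>K + 1\<close>, so if \<open>r * K\<close> is small then about \<open>r\<^sup>2 * K * n\<close> short runs are to
  be expected, nearly independent of each other. The probability that there is none should be
  about \<open>exp (- (r\<^sup>2 * k * n))\<close>, which explains the threshold \<open>r = 1 / sqrt (k * n)\<close> and the limit
  \<open>exp (- (\<alpha>\<^sup>2))\<close> in the critical window.

  The proof does not use moments. The length of the current run, read from left to right and
  stopped as soon as a short run is completed, is a Markov chain, and the probability that it
  survives obeys a linear recursion. Geometric sequences that satisfy the recursion as
  inequalities enclose this probability: \<open>prob_all_long_upper\<close> and \<open>prob_all_long_lower\<close> bound it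
  by exponentials whose exponents both differ from \<open>r\<^sup>2 * k * n\<close> by a vanishing amount if
  \<open>r * sqrt (k * n)\<close> stays bounded. This settles the critical and the subcritical regime together
  (\<open>prob_all_long_tendsto_exp\<close>).

  In the supercritical regime (\<open>prob_all_long_tendsto_0\<close>) the upper bound still suffices unless
  \<open>r\<close> is close to \<open>1\<close>. There the non-breaks may be so few that no run exists with substantial
  probability, and then the event fails because no run of length \<open>K + 1\<close> appears
  (\<open>prob_all_long_le_one_long\<close>).
\<close>

section \<open>Maximal runs of a predicate\<close>

primrec run_len :: "(nat \<Rightarrow> bool) \<Rightarrow> nat \<Rightarrow> nat" where
  "run_len X 0 = 0"
| "run_len X (Suc m) = (if X (Suc m) then Suc (run_len X m) else 0)"

text \<open>
  Only the runs that a \<open>False\<close> at a position up to \<open>n\<close> has ended are tested here. The run still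
  going on at \<open>n\<close> is left open, because it may yet grow; this is what makes the probability of the
  event computable one term at a time. A value \<open>run_len X m = 0\<close> means that no run ends at \<open>m\<close>.
\<close>

definition completed_long :: "nat \<Rightarrow> nat \<Rightarrow> (nat \<Rightarrow> bool) \<Rightarrow> bool" where
  "completed_long K n X \<longleftrightarrow> (\<forall>m<n. \<not> X (Suc m) \<longrightarrow> run_len X m = 0 \<or> K < run_len X m)"

definition all_long :: "nat \<Rightarrow> nat \<Rightarrow> (nat \<Rightarrow> bool) \<Rightarrow> bool" where
  "all_long K n X \<longleftrightarrow> (\<exists>i\<in>{1..n}. X i) \<and> completed_long K n X \<and> (run_len X n = 0 \<or> K < run_len X n)"

lemma run_len_le: "run_len X n \<le> n"
  by (induction n) auto

lemma run_len_in_run: "i \<le> n \<Longrightarrow> n < i + run_len X n \<Longrightarrow> X i"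
  by (induction n) (auto split: if_splits simp: le_Suc_eq)

lemma run_len_maximal: "run_len X n < n \<Longrightarrow> \<not> X (n - run_len X n)"
  by (induction n) (auto split: if_splits simp: Suc_diff_Suc)

lemma run_len_eqI:
  assumes "\<forall>i\<in>{a..b}. X i" "1 \<le> a" "a \<le> Suc b" "a = 1 \<or> \<not> X (a - 1)"
  shows "run_len X b = Suc b - a"
  using assms
proof (induction b)
  case (Suc b)
  show ?case
  proof (cases "a = Suc (Suc b)")
    case False
    then show ?thesis using Suc by auto
  qed (use Suc.prems in auto)
qed auto

text \<open>
  A maximal run is determined by its right end \<open>m\<close>, and then its length is \<open>run_len\<close> at \<open>m\<close>. This
  replaces the quantification over intervals by a scan from left to right.
\<close>

lemma is_maximal_run_iff:
  "is_maximal_run P n C I \<longleftrightarrow>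
     (\<exists>m. m \<le> n \<and> (m = n \<or> \<not> P (C (Suc m))) \<and> 0 < run_len (\<lambda>i. P (C i)) m \<and>
        I = {Suc m - run_len (\<lambda>i. P (C i)) m..m})"
  (is "?L \<longleftrightarrow> ?R")
proof
  let ?X = "\<lambda>i. P (C i)"
  assume L: ?L
  then obtain a b where ab: "1 \<le> a" "a \<le> b" "b \<le> n" "I = {a..b}" "\<forall>i\<in>I. P (C i)"
    unfolding is_maximal_run_def is_run_def by blast
  have mx: "J = I" if "is_run P n C J" "I \<subseteq> J" for J
    using L that unfolding is_maximal_run_def by blast
  have right: "b = n \<or> \<not> P (C (Suc b))"
  proof (rule ccontr)
    assume "\<not> (b = n \<or> \<not> P (C (Suc b)))"
    then have "is_run P n C {a..Suc b}" unfolding is_run_def using ab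
      by (intro conjI exI[of _ a] exI[of _ "Suc b"]) (auto simp: le_Suc_eq)
    from mx[OF this] ab have "{a..Suc b} = {a..b}" by auto
    then have "Suc b \<in> {a..b}" using ab by (metis atLeastAtMost_iff le_Suc_eq)
    then show False by simp
  qed
  have left: "a = 1 \<or> \<not> P (C (a - 1))"
  proof (rule ccontr)
    assume *: "\<not> (a = 1 \<or> \<not> P (C (a - 1)))"
    have "P (C i)" if "i \<in> {a - 1..b}" for i
      using that * ab by (cases "i = a - 1") auto
    then have "is_run P n C {a - 1..b}" unfolding is_run_def using ab *
      by (intro conjI exI[of _ "a - 1"] exI[of _ b]) auto
    from mx[OF this] ab have "{a - 1..b} = {a..b}" by auto
    then have "a - 1 \<in> {a..b}" using ab by (metis atLeastAtMost_iff diff_le_self le_trans order_refl)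
    then show False using ab by auto
  qed
  have "run_len ?X b = Suc b - a" using ab left by (intro run_len_eqI) auto
  then show ?R using ab right by (intro exI[of _ b]) auto
next
  let ?X = "\<lambda>i. P (C i)"
  assume ?R
  then obtain m where m: "m \<le> n" "m = n \<or> \<not> P (C (Suc m))" "0 < run_len ?X m"
    "I = {Suc m - run_len ?X m..m}" by blast
  let ?a = "Suc m - run_len ?X m"
  have le: "run_len ?X m \<le> m" by (rule run_len_le)
  have I: "is_run P n C I"
    unfolding is_run_def using m le run_len_in_run[of _ m ?X]
    by (intro conjI exI[of _ ?a] exI[of _ m]) auto
  have "J = I" if J: "is_run P n C J" "I \<subseteq> J" for J
  proof -
    from J(1) obtain c d where cd: "1 \<le> c" "c \<le> d" "d \<le> n" "J = {c..d}" "\<forall>i\<in>J. P (C i)"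
      unfolding is_run_def by blast
    have sub: "c \<le> ?a" "m \<le> d" using J(2) m cd le by auto
    have "d = m"
    proof (rule ccontr)
      assume "d \<noteq> m"
      then have "Suc m \<in> J" using sub cd by auto
      then show False using m \<open>d \<noteq> m\<close> sub cd by auto
    qed
    moreover have "c = ?a"
    proof (rule ccontr)
      assume "c \<noteq> ?a"
      then have "m - run_len ?X m \<in> J" "run_len ?X m < m" using sub cd m le by auto
      then show False using run_len_maximal[of ?X m] cd by auto
    qed
    ultimately show ?thesis using cd(4) m(4) by (simp only:)
  qed
  then show ?L unfolding is_maximal_run_def using I by blast
qed

text \<open>
  The conditional is the common form of \<^const>\<open>comp_min\<close> and \<^const>\<open>gap_min\<close>. Its value \<open>0\<close> without runs is
  never above \<open>K\<close>, which is why \<^const>\<open>all_long\<close> demands that some term is \<open>True\<close>.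
\<close>

lemma less_min_run_iff:
  fixes P C n
  defines "S \<equiv> {I. is_maximal_run P n C I}"
  shows "K < (if S = {} then 0 else Min (card ` S)) \<longleftrightarrow> all_long K n (\<lambda>i. P (C i))"
proof -
  let ?X = "\<lambda>i. P (C i)"
  have "S \<subseteq> Pow {..n}"
    unfolding S_def is_maximal_run_def is_run_def by auto
  then have fin: "finite (card ` S)" by (meson finite_Pow_iff finite_atMost finite_imageI finite_subset)
  have card: "card ` S = run_len ?X ` {m. m \<le> n \<and> (m = n \<or> \<not> ?X (Suc m)) \<and> 0 < run_len ?X m}"
    (is "_ = run_len ?X ` ?M")
  proof -
    have "S = (\<lambda>m. {Suc m - run_len ?X m..m}) ` ?M"
      unfolding S_def is_maximal_run_iff by auto
    moreover have "card {Suc m - run_len ?X m..m} = run_len ?X m" for m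
      using run_len_le[of ?X m] by simp
    ultimately show ?thesis by (simp add: image_image)
  qed
  have ne: "S \<noteq> {} \<longleftrightarrow> (\<exists>i\<in>{1..n}. ?X i)"
  proof
    assume "S \<noteq> {}"
    then show "\<exists>i\<in>{1..n}. ?X i" unfolding S_def is_maximal_run_def is_run_def by force
  next
    assume "\<exists>i\<in>{1..n}. ?X i"
    then obtain i where i: "1 \<le> i" "i \<le> n" "?X i" by auto
    \<comment> \<open>The last position from \<open>i\<close> on that lies in a run must be the end of one.\<close>
    define m where "m = Max {m. i \<le> m \<and> m \<le> n \<and> 0 < run_len ?X m}"
    have "0 < run_len ?X i" using i by (cases i) auto
    then have "m \<in> {m. i \<le> m \<and> m \<le> n \<and> 0 < run_len ?X m}"
      unfolding m_def using i by (intro Max_in) auto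
    moreover have "m = n \<or> \<not> ?X (Suc m)"
    proof (rule ccontr)
      assume "\<not> ?thesis"
      then have "Suc m \<in> {m. i \<le> m \<and> m \<le> n \<and> 0 < run_len ?X m}"
        using calculation by auto
      then have "Suc m \<le> m" unfolding m_def by (intro Max_ge) auto
      then show False by simp
    qed
    ultimately have "m \<in> ?M" by auto
    then show "S \<noteq> {}" using card by auto
  qed
  have "all_long K n ?X \<longleftrightarrow> (\<exists>i\<in>{1..n}. ?X i) \<and> (\<forall>m\<in>?M. K < run_len ?X m)"
    unfolding all_long_def completed_long_def by (auto simp: le_less)
  also have "\<dots> \<longleftrightarrow> S \<noteq> {} \<and> (\<forall>c\<in>card ` S. K < c)" unfolding card ne by auto
  also have "\<dots> \<longleftrightarrow> K < (if S = {} then 0 else Min (card ` S))"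
    using fin by auto
  finally show ?thesis by blast
qed

section \<open>Reduction to independent coins\<close>

lemma map_geometric_pmf_nonzero:
  assumes "0 \<le> p" "p < 1"
  shows "map_pmf (\<lambda>x. x \<noteq> 0) (geometric_pmf (1 - p)) = bernoulli_pmf p"
proof (rule pmf_eqI)
  fix b
  have *: "(\<lambda>x::nat. x \<noteq> 0) -` {False} = {0}" "(\<lambda>x::nat. x \<noteq> 0) -` {True} = UNIV - {0}" by auto
  show "pmf (map_pmf (\<lambda>x. x \<noteq> 0) (geometric_pmf (1 - p))) b = pmf (bernoulli_pmf p) b"
    using assms measure_pmf.prob_compl[of "{0}" "geometric_pmf (1 - p)"]
    by (cases b) (simp_all add: pmf_map * measure_pmf_single del: neq0_conv)
qed

lemma map_geometric_pmf_zero: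
  assumes "0 \<le> p" "p < 1"
  shows "map_pmf (\<lambda>x. x = 0) (geometric_pmf (1 - p)) = bernoulli_pmf (1 - p)"
proof -
  have "map_pmf Not (map_pmf (\<lambda>x. x \<noteq> 0) (geometric_pmf (1 - p))) = map_pmf Not (bernoulli_pmf p)"
    by (simp only: map_geometric_pmf_nonzero[OF assms])
  moreover have "map_pmf Not (bernoulli_pmf p) = bernoulli_pmf (1 - p)"
  proof (rule pmf_eqI)
    fix b
    have "pmf (map_pmf Not (bernoulli_pmf p)) (\<not> (\<not> b)) = pmf (bernoulli_pmf p) (\<not> b)"
      by (rule pmf_map_inj') (auto simp: inj_def)
    then show "pmf (map_pmf Not (bernoulli_pmf p)) b = pmf (bernoulli_pmf (1 - p)) b"
      using assms by (cases b) auto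
  qed
  ultimately show ?thesis by (simp add: map_pmf_comp)
qed

text \<open>
  \<^const>\<open>Pi_pmf\<close> fixes the values outside \<open>{1..n}\<close> to \<open>dflt\<close>; no event below looks at them, but the
  image of a composition under \<open>\<lambda>x. x \<noteq> 0\<close> has default \<open>False\<close> and its image under \<open>\<lambda>x. x = 0\<close> has
  default \<open>True\<close>, so \<open>dflt\<close> stays a parameter. The parameter \<open>r\<close> is the probability of \<open>False\<close>,
  that is, of a term that ends a run.
\<close>

definition coin_seq :: "bool \<Rightarrow> real \<Rightarrow> nat \<Rightarrow> (nat \<Rightarrow> bool) pmf" where
  "coin_seq dflt r n = Pi_pmf {1..n} dflt (\<lambda>_. bernoulli_pmf (1 - r))"

definition prob_all_long :: "bool \<Rightarrow> real \<Rightarrow> nat \<Rightarrow> nat \<Rightarrow> real" where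
  "prob_all_long dflt r K n = measure_pmf.prob (coin_seq dflt r n) {X. all_long K n X}"

lemma prob_less_min_run:
  assumes "map_pmf P (geometric_pmf (1 - p)) = bernoulli_pmf (1 - r)"
  shows "measure_pmf.prob (random_composition n p)
      {C. K < (if {I. is_maximal_run P n C I} = {} then 0 else Min (card ` {I. is_maximal_run P n C I}))}
    = prob_all_long (P 0) r K n"
proof -
  have "Pi_pmf {1..n} (P 0) (\<lambda>_. bernoulli_pmf (1 - r)) =
      map_pmf (\<lambda>C. P \<circ> C) (random_composition n p)"
    unfolding random_composition_def assms[symmetric] by (intro Pi_pmf_map) auto
  then show ?thesis
    unfolding prob_all_long_def coin_seq_def less_min_run_iff by (simp add: vimage_def comp_def)
qed

lemma less_real_iff_nat_floor_less: "0 < x \<Longrightarrow> x < real m \<longleftrightarrow> nat \<lfloor>x\<rfloor> < m"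
  by linarith

lemma prob_comp_min:
  assumes "0 \<le> p" "p < 1" "0 < x"
  shows "measure_pmf.prob (random_composition n p) {C. real (comp_min n C) > x} =
    prob_all_long False (1 - p) (nat \<lfloor>x\<rfloor>) n"
  unfolding less_real_iff_nat_floor_less[OF assms(3)] comp_min_def components_def
  using prob_less_min_run[of "\<lambda>x. x \<noteq> 0" p "1 - p"] map_geometric_pmf_nonzero[OF assms(1,2)] by simp

lemma prob_gap_min:
  assumes "0 \<le> p" "p < 1" "0 < x"
  shows "measure_pmf.prob (random_composition n p) {C. real (gap_min n C) > x} =
    prob_all_long True p (nat \<lfloor>x\<rfloor>) n"
  unfolding less_real_iff_nat_floor_less[OF assms(3)] gap_min_def gaps_def
  using prob_less_min_run[of "\<lambda>x. x = 0" p p] map_geometric_pmf_zero[OF assms(1,2)] by simp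

section \<open>The recursion for the current run\<close>

lemma prob_Pi_bernoulli_Suc:
  assumes "0 \<le> s" "s \<le> 1"
  shows "measure_pmf.prob (Pi_pmf {1..Suc n} dflt (\<lambda>_. bernoulli_pmf s)) {X. Q X} =
    s * measure_pmf.prob (Pi_pmf {1..n} dflt (\<lambda>_. bernoulli_pmf s)) {X. Q (X(Suc n := True))} +
    (1 - s) * measure_pmf.prob (Pi_pmf {1..n} dflt (\<lambda>_. bernoulli_pmf s)) {X. Q (X(Suc n := False))}"
proof -
  let ?M = "Pi_pmf {1..n} dflt (\<lambda>_. bernoulli_pmf s)"
  have ins: "{1..Suc n} = insert (Suc n) {1..n}" by auto
  have preimage: "(\<lambda>X. X(Suc n := y)) -` {X. Q X} = {X. Q (X(Suc n := y))}" for y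
    by auto
  have "Pi_pmf {1..Suc n} dflt (\<lambda>_. bernoulli_pmf s) =
      bernoulli_pmf s \<bind> (\<lambda>y. map_pmf (\<lambda>X. X(Suc n := y)) ?M)"
    unfolding ins by (subst Pi_pmf_insert') (simp_all add: map_pmf_def)
  then have "emeasure (Pi_pmf {1..Suc n} dflt (\<lambda>_. bernoulli_pmf s)) {X. Q X} =
      ennreal (s * measure_pmf.prob ?M {X. Q (X(Suc n := True))} +
        (1 - s) * measure_pmf.prob ?M {X. Q (X(Suc n := False))})"
    using assms
    by (simp only: emeasure_bind_pmf nn_integral_bernoulli_pmf emeasure_map_pmf preimage)
       (simp add: measure_pmf.emeasure_eq_measure ennreal_mult' mult.commute)
  then show ?thesis
    using assms
    by (subst (asm) measure_pmf.emeasure_eq_measure, subst (asm) ennreal_inj)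
       (auto intro!: add_nonneg_nonneg mult_nonneg_nonneg)
qed

lemma run_len_upd [simp]: "n < i \<Longrightarrow> run_len (X(i := y)) n = run_len X n"
  by (induction n) auto

lemma completed_long_Suc: "completed_long K (Suc n) X \<longleftrightarrow>
    completed_long K n X \<and> (\<not> X (Suc n) \<longrightarrow> run_len X n = 0 \<or> K < run_len X n)"
  by (auto simp: completed_long_def less_Suc_eq)

lemma completed_long_upd [simp]: "n < i \<Longrightarrow> completed_long K n (X(i := y)) \<longleftrightarrow> completed_long K n X"
  by (auto simp: completed_long_def)

definition run_prob :: "bool \<Rightarrow> real \<Rightarrow> nat \<Rightarrow> nat \<Rightarrow> nat \<Rightarrow> real" where
  "run_prob dflt r K n j = measure_pmf.prob (coin_seq dflt r n) {X. completed_long K n X \<and> run_len X n = j}"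

definition long_run_prob :: "bool \<Rightarrow> real \<Rightarrow> nat \<Rightarrow> nat \<Rightarrow> real" where
  "long_run_prob dflt r K n = measure_pmf.prob (coin_seq dflt r n) {X. completed_long K n X \<and> K < run_len X n}"

context
  fixes dflt :: bool and r :: real and K :: nat
  assumes r: "0 \<le> r" "r \<le> 1"
begin

lemma prob_coin_seq_Suc:
  "measure_pmf.prob (coin_seq dflt r (Suc n)) {X. Q X} =
    (1 - r) * measure_pmf.prob (coin_seq dflt r n) {X. Q (X(Suc n := True))} +
    r * measure_pmf.prob (coin_seq dflt r n) {X. Q (X(Suc n := False))}"
  using prob_Pi_bernoulli_Suc[of "1 - r" n dflt Q] r unfolding coin_seq_def by simp

text \<open>
  The current run length is a Markov chain on the states \<open>0, ..., K\<close> and a further state for all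
  longer runs; a \<open>False\<close> in one of the states \<open>1, ..., K\<close> kills it. It starts in state \<open>0\<close>, as if
  a \<open>False\<close> preceded the first term. The recursions for \<^const>\<open>run_prob\<close> and \<^const>\<open>long_run_prob\<close> are its
  transition rules.
\<close>

lemma run_prob_Suc_Suc: "run_prob dflt r K (Suc n) (Suc j) = (1 - r) * run_prob dflt r K n j"
  unfolding run_prob_def by (subst prob_coin_seq_Suc) (simp add: completed_long_Suc)

lemma prob_run_0_or_long:
  "measure_pmf.prob (coin_seq dflt r n) {X. completed_long K n X \<and> (run_len X n = 0 \<or> K < run_len X n)} =
    run_prob dflt r K n 0 + long_run_prob dflt r K n"
  unfolding run_prob_def long_run_prob_def
  by (subst measure_pmf.finite_measure_Union[symmetric]) (auto intro!: arg_cong[where f = "measure _"])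

lemma prob_extended:
  "measure_pmf.prob (coin_seq dflt r n) {X. completed_long K n X \<and> K < Suc (run_len X n)} =
    long_run_prob dflt r K n + run_prob dflt r K n K"
  unfolding run_prob_def long_run_prob_def
  by (subst measure_pmf.finite_measure_Union[symmetric]) (auto intro!: arg_cong[where f = "measure _"])

lemma run_prob_Suc_0:
  "run_prob dflt r K (Suc n) 0 = r * (run_prob dflt r K n 0 + long_run_prob dflt r K n)"
  unfolding prob_run_0_or_long[symmetric]
  by (subst run_prob_def, subst prob_coin_seq_Suc) (simp add: completed_long_Suc)

lemma long_run_prob_Suc:
  "long_run_prob dflt r K (Suc n) = (1 - r) * (long_run_prob dflt r K n + run_prob dflt r K n K)"
  unfolding prob_extended[symmetric]
  by (subst long_run_prob_def, subst prob_coin_seq_Suc) (simp add: completed_long_Suc)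

lemma run_prob_0_0: "run_prob dflt r K 0 0 = 1"
  by (simp add: run_prob_def completed_long_def)

lemma long_run_prob_eq_0: "n \<le> K \<Longrightarrow> long_run_prob dflt r K n = 0"
  unfolding long_run_prob_def using run_len_le[of _ n]
  by (subst measure_pmf.prob_eq_0) (auto simp: not_less intro: order_trans)

lemma run_prob_eq_0: "n < j \<Longrightarrow> run_prob dflt r K n j = 0"
  unfolding run_prob_def using run_len_le[of _ n]
  by (subst measure_pmf.prob_eq_0) (auto simp: not_less dest: leD)

lemma run_prob_nonneg: "0 \<le> run_prob dflt r K n j"
  by (simp add: run_prob_def)

lemma run_prob_add: "run_prob dflt r K (n + j) j = (1 - r) ^ j * run_prob dflt r K n 0"
  by (induction j) (simp_all add: run_prob_Suc_Suc)

lemma prob_all_long_Suc: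
  "prob_all_long dflt r K (Suc n) = long_run_prob dflt r K (Suc n) + r * prob_all_long dflt r K n"
proof -
  have "\<exists>i\<in>{1..Suc n}. (X(Suc n := True)) i" for X
    by (intro bexI[of _ "Suc n"]) auto
  then have T: "all_long K (Suc n) (X(Suc n := True)) \<longleftrightarrow> completed_long K n X \<and> K < Suc (run_len X n)" for X
    unfolding all_long_def by (simp add: completed_long_Suc)
  have "(\<exists>i\<in>{1..Suc n}. (X(Suc n := False)) i) \<longleftrightarrow> (\<exists>i\<in>{1..n}. X i)" for X
    by (auto simp: atLeastAtMostSuc_conv)
  then have F: "all_long K (Suc n) (X(Suc n := False)) \<longleftrightarrow> all_long K n X" for X
    unfolding all_long_def by (simp add: completed_long_Suc)
  show ?thesis
    unfolding prob_all_long_def long_run_prob_Suc prob_extended[symmetric]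
    by (subst prob_coin_seq_Suc) (simp only: T F)
qed

lemma prob_all_long_0: "prob_all_long dflt r K 0 = 0"
  by (simp add: prob_all_long_def all_long_def)

lemma prob_all_long_nonneg: "0 \<le> prob_all_long dflt r K n"
  by (simp add: prob_all_long_def)

lemma long_run_prob_le: "long_run_prob dflt r K n \<le> prob_all_long dflt r K n"
  by (cases n) (use r prob_all_long_nonneg in \<open>auto simp: prob_all_long_Suc long_run_prob_eq_0 prob_all_long_0\<close>)

lemma prob_all_long_le: "prob_all_long dflt r K n \<le> run_prob dflt r K n 0 + long_run_prob dflt r K n"
  unfolding prob_run_0_or_long[symmetric] prob_all_long_def
  by (intro measure_pmf.finite_measure_mono) (auto simp: all_long_def)

section \<open>Bounds for all parameters\<close>

text \<open>
  Some run must exceed \<open>K\<close>, and \<open>Suc K\<close> consecutive \<open>True\<close> have probability \<open>(1 - r) ^ Suc K\<close>.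
  This bound serves when \<open>r\<close> is so close to \<open>1\<close> that the sequence may contain hardly any run at
  all; the exponential bound below is then worthless, because a sequence without runs has no short
  one.
\<close>

lemma prob_all_long_le_one_long: "prob_all_long dflt r K n \<le> n * (1 - r) ^ Suc K"
proof (induction n)
  case (Suc n)
  have "run_prob dflt r K n K \<le> (1 - r) ^ K"
  proof (cases "n < K")
    case True
    then show ?thesis using r by (simp add: run_prob_eq_0)
  next
    case False
    have "run_prob dflt r K (n - K) 0 \<le> 1" by (simp add: run_prob_def)
    then show ?thesis
      using r False run_prob_add[of "n - K" K] by (simp add: mult_left_le)
  qed
  then have "long_run_prob dflt r K (Suc n) \<le> (1 - r) * (prob_all_long dflt r K n + (1 - r) ^ K)"
    unfolding long_run_prob_Suc using r long_run_prob_le[of n] by (intro mult_left_mono add_mono) auto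
  then show ?case using Suc by (simp add: prob_all_long_Suc algebra_simps)
qed (simp add: prob_all_long_0)

lemma long_run_prob_ge_all: "K < n \<Longrightarrow> (1 - r) ^ n \<le> long_run_prob dflt r K n"
proof (induction n)
  case (Suc n)
  show ?case
  proof (cases "n = K")
    case True
    then show ?thesis
      using r run_prob_add[of 0 K] by (simp add: long_run_prob_Suc long_run_prob_eq_0 run_prob_0_0)
  next
    case False
    then show ?thesis
      using Suc r run_prob_nonneg[of n K] unfolding long_run_prob_Suc power_Suc
      by (intro mult_left_mono) (auto intro: order_trans)
  qed
qed simp

text \<open>
  A long current run remains long if the next term is \<open>True\<close>; and if the next term is \<open>False\<close> and
  then \<open>Suc K\<close> times \<open>True\<close> follow, there is a new long run. Keeping only these two continuations
  gives, for the probability \<open>long n\<close> that all runs up to \<open>n\<close> and the current one are long,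
  \<open>long (n + K + 2) \<ge> (1 - r) * long (n + K + 1) + r * (1 - r) ^ Suc K * long n\<close>, and a sequence
  decreasing by the factor \<open>1 - r + r * (1 - r) ^ Suc K\<close> per step satisfies the reverse inequality
  because the factor is at most \<open>1\<close>. The leading power covers the first \<open>2 * K + 2\<close> terms, which
  may all be \<open>True\<close>.
\<close>

lemma long_run_prob_lower:
  assumes "K < n"
  shows "(1 - r) ^ (2 * K + 2) * (1 - r + r * (1 - r) ^ Suc K) ^ n \<le> long_run_prob dflt r K n"
  using assms
proof (induction n rule: less_induct)
  case (less n)
  let ?s = "1 - r"
  let ?l = "?s + r * ?s ^ Suc K"
  have pow1: "?s ^ Suc K \<le> 1" using r by (intro power_le_one) auto
  have l: "0 \<le> ?l" "?l \<le> 1"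
    using r mult_left_mono[OF pow1 r(1)] by auto
  show ?case
  proof (cases "n \<le> 2 * K + 2")
    case True
    have "?s ^ (2 * K + 2) * ?l ^ n \<le> ?s ^ (2 * K + 2)"
      using r l by (intro mult_right_le_one_le power_le_one) auto
    also have "\<dots> \<le> ?s ^ n" using True r by (intro power_decreasing) auto
    also have "\<dots> \<le> long_run_prob dflt r K n" using less.prems by (rule long_run_prob_ge_all)
    finally show ?thesis .
  next
    case False
    define m where "m = n - Suc (Suc K)"
    have n: "n = Suc (Suc m + K)" and m: "K < m" using False by (auto simp: m_def)
    have "?s ^ (2 * K + 2) * ?l ^ n = ?s * (?s ^ (2 * K + 2) * ?l ^ (Suc m + K)) +
        r * ?s ^ Suc K * (?s ^ (2 * K + 2) * (?l ^ m * ?l ^ Suc K))"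
      unfolding n power_Suc[of ?l] power_add[symmetric]
      by (simp add: algebra_simps power_add)
    also have "?l ^ m * ?l ^ Suc K \<le> ?l ^ m"
      using l by (intro mult_right_le_one_le power_le_one) auto
    also have "?s ^ (2 * K + 2) * ?l ^ (Suc m + K) \<le> long_run_prob dflt r K (Suc m + K)"
      using less.IH[of "Suc m + K"] m n by auto
    also have "?s ^ (2 * K + 2) * ?l ^ m \<le> long_run_prob dflt r K m"
      using less.IH[of m] m n by auto
    also have "?s * long_run_prob dflt r K (Suc m + K) + r * ?s ^ Suc K * long_run_prob dflt r K m \<le>
        ?s * (long_run_prob dflt r K (Suc m + K) + ?s ^ K * (r * (run_prob dflt r K m 0 + long_run_prob dflt r K m)))"
    proof -
      have "0 \<le> ?s * ?s ^ K * (r * run_prob dflt r K m 0)"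
        using r run_prob_nonneg[of m 0] by (intro mult_nonneg_nonneg) auto
      then show ?thesis by (simp add: algebra_simps)
    qed
    also have "\<dots> = long_run_prob dflt r K n"
      unfolding n long_run_prob_Suc run_prob_add run_prob_Suc_0 ..
    finally show ?thesis using r by (simp add: mult_left_mono)
  qed
qed

text \<open>
  A geometric supersolution of the recursion. If \<open>g\<close> is the probability that no run is short and
  \<open>h\<close> the probability that moreover the current run is long, then \<open>g n = r * g (n - 1) + h n\<close>, so
  \<open>g n = l ^ n\<close> forces \<open>h n = (1 - r / l) * l ^ n\<close>; both are bounded simultaneously. The
  hypothesis \<open>base\<close> is what the first possible long run requires (it appears at time \<open>Suc K\<close>,
  coming from the initial state), and \<open>step\<close> is what every later time requires, where equality in
  \<open>step\<close> would make the pair an exact solution.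
\<close>

lemma survival_le_power:
  fixes l :: real
  assumes l: "0 < l" "l \<le> 1" "r \<le> l"
    and base: "(1 - r) ^ Suc K \<le> (l - r) * l ^ K"
    and step: "r * (1 - r) ^ Suc K \<le> (l - r) * l ^ K * (l - (1 - r))"
  shows "run_prob dflt r K n 0 + long_run_prob dflt r K n \<le> l ^ n"
proof -
  have "run_prob dflt r K n 0 + long_run_prob dflt r K n \<le> l ^ n \<and>
      l * long_run_prob dflt r K n \<le> (l - r) * l ^ n"
  proof (induction n rule: less_induct)
    case (less n)
    show ?case
    proof (cases n)
      case 0
      then show ?thesis using l by (simp add: run_prob_0_0 long_run_prob_eq_0)
    next
      case (Suc m)
      have IH: "run_prob dflt r K m 0 + long_run_prob dflt r K m \<le> l ^ m"
        "l * long_run_prob dflt r K m \<le> (l - r) * l ^ m" using less Suc by auto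
      have long: "l * long_run_prob dflt r K (Suc m) \<le> (l - r) * l ^ Suc m"
      proof -
        consider "m < K" | "m = K" | j where "m = Suc j + K"
          by (metis add.commute add_Suc_right less_imp_Suc_add linorder_neqE_nat)
        then show ?thesis
        proof cases
          case 1
          then show ?thesis using l by (simp add: long_run_prob_eq_0)
        next
          case 2
          have "long_run_prob dflt r K (Suc m) = (1 - r) ^ Suc K"
            using 2 run_prob_add[of 0 K] by (simp add: long_run_prob_Suc long_run_prob_eq_0 run_prob_0_0)
          then show ?thesis using mult_left_mono[OF base, of l] l 2 by (simp only:) (simp add: mult_ac)
        next
          case 3
          have IHj: "run_prob dflt r K j 0 + long_run_prob dflt r K j \<le> l ^ j" using less Suc 3 by auto
          have "l * long_run_prob dflt r K (Suc m) = (1 - r) * (l * long_run_prob dflt r K m) +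
              l * (r * (1 - r) ^ Suc K * (run_prob dflt r K j 0 + long_run_prob dflt r K j))"
            unfolding long_run_prob_Suc 3 run_prob_add run_prob_Suc_0 by (simp add: algebra_simps)
          also have "\<dots> \<le> (1 - r) * ((l - r) * l ^ m) + l * (r * (1 - r) ^ Suc K * l ^ j)"
            using IH(2) IHj l r by (intro add_mono mult_left_mono) auto
          also have "\<dots> = (1 - r) * ((l - r) * l ^ m) + (r * (1 - r) ^ Suc K) * l ^ Suc j"
            by simp
          also have "\<dots> \<le> (1 - r) * ((l - r) * l ^ m) + ((l - r) * l ^ K * (l - (1 - r))) * l ^ Suc j"
            using step l by (intro add_mono mult_right_mono) auto
          also have "\<dots> = (l - r) * l ^ Suc m"
            unfolding 3 by (simp add: algebra_simps power_add)
          finally show ?thesis .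
        qed
      qed
      have "l * run_prob dflt r K (Suc m) 0 \<le> r * l ^ Suc m"
        unfolding run_prob_Suc_0 using mult_left_mono[OF IH(1), of "l * r"] l r by (simp add: mult_ac)
      with long have "l * (run_prob dflt r K (Suc m) 0 + long_run_prob dflt r K (Suc m)) \<le> l * l ^ Suc m"
        by (simp add: algebra_simps)
      then show ?thesis using long l Suc by simp
    qed
  qed
  then show ?thesis by blast
qed

text \<open>
  A rate that meets the hypotheses of the supersolution. Substituting \<open>l = 1 - r * d\<close> turns \<open>step\<close>
  into \<open>r\<close> times the last claim. If \<open>r * K\<close> is small, the solution \<open>d\<close> of the corresponding
  equation is close to the probability \<open>(1 - r) * (1 - (1 - r) ^ K)\<close> that a break is followed by a
  run of length between \<open>1\<close> and \<open>K\<close>. That solution has no simple closed form; the value chosen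
  here replaces \<open>1 - (1 - x) ^ K\<close> by its lower bound \<open>K * x / (1 + K * x)\<close>, and the \<open>2\<close> in its
  denominator leaves room for the difference between \<open>x = r * (1 - d)\<close> and \<open>r\<close>. It is exact to
  first order in \<open>r * K\<close>, hence sharp enough for the critical window, and valid for every \<open>r\<close>.
\<close>

lemma decay_rate:
  fixes d l :: real
  defines "d \<equiv> (1 - r) * (r * K) / (1 + 2 * (r * K))"
  defines "l \<equiv> 1 - r * d"
  shows "0 \<le> d" "d \<le> 1 / 2" "r \<le> l" "(1 - r) ^ Suc K \<le> (1 - d) * (l - r) * l ^ K"
proof -
  define t where "t = r * K"
  have t: "0 \<le> t" using r by (simp add: t_def)
  define e where "e = t / (1 + 2 * t)"
  have e: "0 \<le> e" "e \<le> 1 / 2" using t by (auto simp: e_def field_simps)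
  have de: "d = (1 - r) * e" by (simp add: d_def e_def t_def)
  show d: "0 \<le> d" "d \<le> 1 / 2"
    using r e mult_mono[of "1 - r" 1 e "1 / 2"] by (auto simp: de)
  have "d \<le> 1 - r" "d \<le> e"
    using r e by (auto simp: de mult_left_le mult_right_le_one_le mult_left_le_one_le)
  have rd: "r * d \<le> d" "r * d \<le> 1 / 2" using r d mult_right_le_one_le[of d r]
    by (auto simp: mult.commute)
  then show "r \<le> l" using \<open>d \<le> 1 - r\<close> by (simp add: l_def)
  \<comment> \<open>Chosen so that \<open>1 - x\<close> bounds the ratio of \<open>1 - r\<close> to \<open>l\<close>, whose \<open>K\<close>-th power matters.\<close>
  define x where "x = r * (1 - d)"
  have x: "0 \<le> x" "x \<le> 1" using r d mult_mono[of r 1 "1 - d" 1] by (auto simp: x_def)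
  have l0: "0 < l" using rd by (simp add: l_def)
  have "1 - r \<le> l * (1 - x)"
  proof -
    have "l * (1 - x) - (1 - r) = r\<^sup>2 * (d * (1 - d))"
      by (simp add: l_def x_def algebra_simps power2_eq_square)
    moreover have "0 \<le> r\<^sup>2 * (d * (1 - d))" using d by (intro mult_nonneg_nonneg) auto
    ultimately show ?thesis by linarith
  qed
  then have pow: "(1 - r) ^ K \<le> l ^ K * (1 - x) ^ K"
    using r by (metis power_mono power_mult_distrib diff_ge_0_iff_ge)
  \<comment> \<open>The lower bound \<open>K * x / (1 + K * x)\<close> for \<open>1 - (1 - x) ^ K\<close>, without division.\<close>
  have "(1 - x) ^ K * (1 + K * x) \<le> (1 - x) ^ K * (1 + x) ^ K"
    using x Bernoulli_inequality[of x K] by (intro mult_left_mono) auto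
  also have "\<dots> = (1 - x\<^sup>2) ^ K"
    by (simp add: power_mult_distrib[symmetric] algebra_simps power2_eq_square)
  also have "\<dots> \<le> 1" using x by (intro power_le_one) (auto simp: power_le_one)
  finally have bern: "(1 - x) ^ K * (1 + K * x) \<le> 1" .
  \<comment> \<open>The inequality that dictates the shape of \<open>e\<close>: it fails for \<open>e = t / (1 + t)\<close> if \<open>t > 0\<close>.\<close>
  have "1 \<le> (1 - e) * (1 + t * (1 - e))"
  proof -
    have "1 - e = (1 + t) / (1 + 2 * t)" using t by (simp add: e_def field_simps)
    then have "(1 - e) * (1 + t * (1 - e)) = ((1 + t) * (1 + 3 * t + t\<^sup>2)) / (1 + 2 * t)\<^sup>2"
      using t by (simp add: power2_eq_square) (simp add: field_simps)
    moreover have "(1 + 2 * t)\<^sup>2 \<le> (1 + t) * (1 + 3 * t + t\<^sup>2)"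
      using t by (simp add: power2_eq_square algebra_simps)
    ultimately show ?thesis using t by simp
  qed
  also have "\<dots> \<le> (1 - e) * (1 + t * (1 - d))"
    using e t \<open>d \<le> e\<close> by (intro mult_left_mono add_mono) auto
  finally have "(1 - r) * 1 \<le> (1 - r) * ((1 - e) * (1 + t * (1 - d)))"
    using r by (intro mult_left_mono) auto
  also have "\<dots> = (1 - r - d) * (1 + K * x)"
    by (simp add: de x_def t_def algebra_simps)
  also have "\<dots> \<le> (1 - d) * (l - r) * (1 + K * x)"
  proof -
    have "(1 - d) * (l - r) = 1 - r - d + r * d\<^sup>2"
      by (simp add: l_def algebra_simps power2_eq_square)
    then show ?thesis using r x by (intro mult_right_mono) auto
  qed
  finally have main: "1 - r \<le> (1 - d) * (l - r) * (1 + K * x)" by simp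
  have "(1 - r) ^ Suc K \<le> (l ^ K * (1 - x) ^ K) * ((1 - d) * (l - r) * (1 + K * x))"
    unfolding power_Suc2 using pow main r x l0 by (intro mult_mono) auto
  also have "\<dots> = (1 - d) * (l - r) * l ^ K * ((1 - x) ^ K * (1 + K * x))"
    by (simp add: mult_ac)
  also have "\<dots> \<le> (1 - d) * (l - r) * l ^ K"
    using bern d l0 \<open>r \<le> l\<close> x by (intro mult_left_le) auto
  finally show "(1 - r) ^ Suc K \<le> (1 - d) * (l - r) * l ^ K" .
qed

text \<open>
  With \<open>t = r * K\<close> the exponent is \<open>n * r * (1 - r) * t / (1 + 2 * t)\<close>. For small \<open>r * K\<close> it is
  about \<open>r\<^sup>2 * K * n\<close>, the expected number of short runs; for large \<open>r * K\<close> it is of order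
  \<open>r * (1 - r) * n\<close>, the number of runs of any length.
\<close>

lemma prob_all_long_upper:
  "prob_all_long dflt r K n \<le> exp (- (n * (r * (1 - r) * (r * K / (1 + 2 * (r * K))))))"
proof -
  define d where "d = (1 - r) * (r * K) / (1 + 2 * (r * K))"
  define l where "l = 1 - r * d"
  note rate = decay_rate[folded d_def, folded l_def]
  have "r * d \<le> 1 / 2" using rate(1,2) r mult_mono[of r 1 d "1 / 2"] by auto
  moreover have "0 \<le> r * d" using rate(1) r by auto
  ultimately have l: "0 < l" "l \<le> 1" by (auto simp: l_def)
  have nn: "0 \<le> (l - r) * l ^ K" using l rate(3) by auto
  have base: "(1 - r) ^ Suc K \<le> (l - r) * l ^ K"
    using rate(4) mult_right_mono[of "1 - d" 1 "(l - r) * l ^ K"] nn rate(1) by (simp add: mult.assoc)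
  have step: "r * (1 - r) ^ Suc K \<le> (l - r) * l ^ K * (l - (1 - r))"
    using mult_left_mono[OF rate(4) r(1)] by (simp add: l_def algebra_simps)
  have "prob_all_long dflt r K n \<le> l ^ n"
    using prob_all_long_le survival_le_power[OF l rate(3) base step] by (rule order_trans)
  also have "\<dots> \<le> exp (- (r * d)) ^ n"
    using l exp_ge_add_one_self[of "- (r * d)"] by (intro power_mono) (auto simp: l_def)
  also have "\<dots> = exp (- (n * (r * d)))" by (simp add: exp_of_nat_mult[symmetric])
  finally show ?thesis by (simp add: d_def mult_ac)
qed

text \<open>
  Here the exponent is again \<open>r\<^sup>2 * K * n\<close> up to terms that vanish in the critical window. The
  rate of \<open>long_run_prob_lower\<close> enters through \<open>1 - r + r * (1 - r) ^ Suc K \<ge> 1 - r\<^sup>2 * Suc K\<close>.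
\<close>

lemma prob_all_long_lower:
  assumes "K < n" "r < 1" "r\<^sup>2 * Suc K < 1"
  shows "exp (- (2 * (Suc K * r) / (1 - r) + n * (r\<^sup>2 * Suc K) / (1 - r\<^sup>2 * Suc K)))
    \<le> prob_all_long dflt r K n"
proof -
  define x where "x = r\<^sup>2 * Suc K"
  have exp_le: "exp (- (m * (y / (1 - y)))) \<le> (1 - y) ^ m" if "y < 1" for y :: real and m :: nat
  proof -
    have "1 / (1 - y) = 1 + y / (1 - y)" using that by (simp add: field_simps)
    also have "\<dots> \<le> exp (y / (1 - y))" by (rule exp_ge_add_one_self)
    finally have "exp (- (y / (1 - y))) \<le> 1 - y" using that by (simp add: exp_minus field_simps)
    then have "exp (- (y / (1 - y))) ^ m \<le> (1 - y) ^ m" by (intro power_mono) auto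
    then show ?thesis by (simp add: exp_of_nat_mult[symmetric])
  qed
  have bern: "1 - x \<le> 1 - r + r * (1 - r) ^ Suc K"
    using mult_left_mono[OF Bernoulli_inequality[of "- r" "Suc K"] r(1)] r
    by (simp add: x_def algebra_simps power2_eq_square)
  have "exp (- (2 * (Suc K * r) / (1 - r) + n * x / (1 - x))) =
      exp (- (real (2 * K + 2) * (r / (1 - r)))) * exp (- (n * (x / (1 - x))))"
    by (simp add: exp_add[symmetric] algebra_simps add_divide_distrib)
  also have "\<dots> \<le> (1 - r) ^ (2 * K + 2) * (1 - x) ^ n"
    using assms r exp_le[of r "2 * K + 2"] exp_le[of x n] by (intro mult_mono) (auto simp: x_def)
  also have "\<dots> \<le> (1 - r) ^ (2 * K + 2) * (1 - r + r * (1 - r) ^ Suc K) ^ n"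
    using r bern assms by (intro mult_left_mono power_mono) (auto simp: x_def)
  also have "\<dots> \<le> prob_all_long dflt r K n"
    using long_run_prob_lower[OF assms(1)] long_run_prob_le by (rule order_trans)
  finally show ?thesis by (simp add: x_def)
qed

end

section \<open>Limits\<close>

text \<open>
  The two hypotheses on \<open>r\<close>, \<open>K\<close> and \<open>n\<close> correspond to the two regimes of the exponent in
  \<open>prob_all_long_upper\<close>: the first is used if \<open>r * K \<le> 1\<close>, the second otherwise.
\<close>

lemma prob_all_long_le_rare:
  assumes "0 \<le> r" "r \<le> 1 / 2" "1 \<le> \<rho>" "\<rho>\<^sup>2 \<le> 2 * (r\<^sup>2 * K * n)" "\<rho> \<le> r * n"
  shows "prob_all_long dflt r K n \<le> exp (- (\<rho> / 12))"
proof -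
  define t where "t = r * K"
  have t: "0 \<le> t" using assms by (simp add: t_def)
  have "\<rho> / 12 \<le> n * (r * (1 - r) * (t / (1 + 2 * t)))"
  proof (cases "t \<le> 1")
    case True
    have "\<rho> * 1 \<le> \<rho>\<^sup>2" unfolding power2_eq_square using assms by (intro mult_left_mono) auto
    then have "\<rho> \<le> 2 * (r\<^sup>2 * K * n)" using assms(4) by simp
    then have "\<rho> / 12 \<le> (n * r) * ((1 / 2) * (t / 3))"
      by (simp add: t_def power2_eq_square mult_ac)
    also have "\<dots> \<le> (n * r) * ((1 - r) * (t / (1 + 2 * t)))"
      using assms t True by (intro mult_left_mono mult_mono divide_left_mono) auto
    finally show ?thesis by (simp add: mult_ac)
  next
    case False
    have "\<rho> / 12 \<le> (n * r) * ((1 / 2) * (1 / 3))"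
      using assms by (simp add: mult_ac)
    also have "\<dots> \<le> (n * r) * ((1 - r) * (t / (1 + 2 * t)))"
      using assms False by (intro mult_left_mono mult_mono) (auto simp: field_simps)
    finally show ?thesis by (simp add: mult_ac)
  qed
  then have "exp (- (n * (r * (1 - r) * (t / (1 + 2 * t))))) \<le> exp (- (\<rho> / 12))" by simp
  then show ?thesis
    using prob_all_long_upper[where r = r and K = K and n = n and dflt = dflt] assms(1,2) unfolding t_def by linarith
qed

text \<open>
  For \<open>r \<ge> 1 / 2\<close> the number of \<open>True\<close>, about \<open>n * (1 - r)\<close>, may be anything between \<open>0\<close> and
  \<open>n / 2\<close>. If it is small, then even two adjacent \<open>True\<close> are unlikely; if it is large, there are
  many runs, a positive fraction of them of length \<open>1\<close>. The threshold between the two cases is the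
  fourth root of \<open>n\<close>.
\<close>

lemma prob_all_long_le_frequent:
  assumes "1 / 2 \<le> r" "r \<le> 1" "1 \<le> K" "1 \<le> n"
  shows "prob_all_long dflt r K n \<le> 9 / sqrt (sqrt n)"
proof -
  define s where "s = 1 - r"
  define y where "y = sqrt (sqrt n)"
  have y: "1 \<le> y" "y\<^sup>2 * y\<^sup>2 = n" using assms by (simp_all add: y_def)
  have s: "0 \<le> s" "s \<le> 1" using assms by (auto simp: s_def)
  show ?thesis
  proof (cases "n * s \<le> y")
    case True
    have "prob_all_long dflt r K n \<le> n * s ^ Suc K"
      using prob_all_long_le_one_long[where r = r and K = K and n = n and dflt = dflt] assms by (simp add: s_def)
    also have "\<dots> \<le> n * s\<^sup>2"
      using s assms by (intro mult_left_mono power_decreasing) auto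
    also have "\<dots> = (n * s)\<^sup>2 / n" using assms by (simp add: power2_eq_square)
    also have "\<dots> \<le> y\<^sup>2 / n" using True s by (intro divide_right_mono power_mono) auto
    also have "\<dots> = 1 / y\<^sup>2" unfolding y(2)[symmetric] using y(1)
      by (simp only: divide_divide_eq_left[symmetric]) simp
    also have "\<dots> \<le> 9 / y"
      using y(1) self_le_power[of y 2] by (intro frac_le) auto
    finally show ?thesis by (simp add: y_def)
  next
    case False
    define t where "t = r * K"
    have t: "1 / 2 \<le> t" using mult_mono[of "1 / 2" r 1 "real K"] assms by (auto simp: t_def)
    have "1 / 8 = (1 / 2) * (1 / (4::real))" by simp
    also have "\<dots> \<le> r * (t / (1 + 2 * t))"
      using t assms by (intro mult_mono) (auto simp: field_simps)
    finally have "(n * s) * (1 / 8) \<le> (n * s) * (r * (t / (1 + 2 * t)))"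
      using s by (intro mult_left_mono) auto
    then have "n * s / 8 \<le> n * (r * (1 - r) * (t / (1 + 2 * t)))" by (simp add: s_def mult_ac)
    then have "exp (- (n * (r * (1 - r) * (t / (1 + 2 * t))))) \<le> exp (- (n * s / 8))" by simp
    then have "prob_all_long dflt r K n \<le> exp (- (n * s / 8))"
      using prob_all_long_upper[where r = r and K = K and n = n and dflt = dflt] assms(1,2) unfolding t_def by linarith
    also have "\<dots> \<le> exp (- (y / 8))" using False by simp
    also have "\<dots> \<le> 8 / y"
      using exp_ge_add_one_self[of "y / 8"] y by (simp add: exp_minus field_simps)
    also have "\<dots> \<le> 9 / y" using y by (intro divide_right_mono) auto
    finally show ?thesis by (simp add: y_def)
  qed
qed

context
  fixes k r :: "nat \<Rightarrow> real"
  assumes r: "\<And>n. 0 \<le> r n" "\<And>n. r n \<le> 1"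
    and k_pos: "\<And>n. 0 < k n"
    and k_inf: "(\<lambda>n. 1 / k n) \<longlonglongrightarrow> 0"
    and k_less: "(\<lambda>n. k n / n) \<longlonglongrightarrow> 0"
begin

lemma floor_bounds: "real (nat \<lfloor>k n\<rfloor>) \<le> k n" "k n - 1 \<le> real (nat \<lfloor>k n\<rfloor>)"
  using k_pos[of n] by linarith+

lemma prob_all_long_tendsto_0:
  assumes "filterlim (\<lambda>n. r n * sqrt (k n * n)) at_top sequentially"
  shows "(\<lambda>n. prob_all_long dflt (r n) (nat \<lfloor>k n\<rfloor>) n) \<longlonglongrightarrow> 0"
proof (rule tendsto_sandwich[where f = "\<lambda>_. 0"])
  define \<rho> where "\<rho> = (\<lambda>n. r n * sqrt (k n * n))"
  have \<rho>: "filterlim \<rho> at_top sequentially" using assms by (simp add: \<rho>_def)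
  have "eventually (\<lambda>n. 1 / k n < 1 / 2) sequentially" "eventually (\<lambda>n. k n / n < 1) sequentially"
    using order_tendstoD(2)[OF k_inf, of "1 / 2"] order_tendstoD(2)[OF k_less, of 1] by auto
  moreover have "eventually (\<lambda>n. 1 \<le> \<rho> n) sequentially"
    using \<rho> by (simp add: filterlim_at_top)
  ultimately show "eventually (\<lambda>n. prob_all_long dflt (r n) (nat \<lfloor>k n\<rfloor>) n \<le>
      exp (- (\<rho> n / 12)) + 9 / sqrt (sqrt n)) sequentially"
    using eventually_gt_at_top[of 0]
  proof eventually_elim
    case (elim n)
    have k: "2 < k n" "k n < n" using elim k_pos[of n] by (auto simp: field_simps)
    define K where "K = nat \<lfloor>k n\<rfloor>"
    have K: "k n \<le> 2 * K" "1 \<le> real K" using k floor_bounds[of n] unfolding K_def by linarith+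
    show ?case
    proof (cases "r n \<le> 1 / 2")
      case True
      have "(\<rho> n)\<^sup>2 = (r n)\<^sup>2 * (k n * n)" using k by (simp add: \<rho>_def power_mult_distrib)
      also have "\<dots> \<le> (r n)\<^sup>2 * ((2 * K) * n)"
        using mult_right_mono[OF K(1), of "real n"] by (intro mult_left_mono) auto
      finally have "(\<rho> n)\<^sup>2 \<le> 2 * ((r n)\<^sup>2 * K * n)" by (simp add: mult_ac)
      moreover have "\<rho> n \<le> r n * n"
      proof -
        have "sqrt (k n * n) \<le> sqrt (real n * n)"
          using k by (intro real_sqrt_le_mono mult_right_mono) auto
        then show ?thesis unfolding \<rho>_def using r by (intro mult_left_mono) auto
      qed
      ultimately have "prob_all_long dflt (r n) K n \<le> exp (- (\<rho> n / 12))"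
        using True r elim by (intro prob_all_long_le_rare) auto
      then show ?thesis unfolding K_def by (simp add: add_increasing2)
    next
      case False
      have "prob_all_long dflt (r n) K n \<le> 9 / sqrt (sqrt n)"
        using False r K elim by (intro prob_all_long_le_frequent) auto
      then show ?thesis unfolding K_def by (simp add: add_increasing)
    qed
  qed
  have "(\<lambda>n. exp (- (\<rho> n * (1 / 12)))) \<longlonglongrightarrow> 0"
    by (intro filterlim_compose[OF exp_at_bot] filterlim_compose[OF filterlim_uminus_at_bot_at_top]
        filterlim_at_top_mult_tendsto_pos[OF tendsto_const _ \<rho>]) auto
  moreover have "(\<lambda>n. 9 / sqrt (sqrt (real n))) \<longlonglongrightarrow> 0"
    by (intro tendsto_divide_0[OF tendsto_const] filterlim_at_top_imp_at_infinity
        filterlim_compose[OF sqrt_at_top] filterlim_real_sequentially)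
  ultimately show "(\<lambda>n. exp (- (\<rho> n / 12)) + 9 / sqrt (sqrt (real n))) \<longlonglongrightarrow> 0"
    using tendsto_add by fastforce
qed (use prob_all_long_nonneg r in auto)

text \<open>
  The subcritical regime is the case \<open>a = 0\<close>. Convergence of \<open>r * sqrt (k * n)\<close> makes \<open>r\<close> and
  \<open>r * k\<close> vanish, because \<open>k\<close> and \<open>n / k\<close> tend to infinity; then all error terms in the two
  exponents vanish, and what remains of both is \<open>r\<^sup>2 * k * n\<close>, with limit \<open>a\<^sup>2\<close>.
\<close>

lemma prob_all_long_tendsto_exp:
  assumes \<rho>: "(\<lambda>n. r n * sqrt (k n * n)) \<longlonglongrightarrow> a"
  shows "(\<lambda>n. prob_all_long dflt (r n) (nat \<lfloor>k n\<rfloor>) n) \<longlonglongrightarrow> exp (- (a\<^sup>2))"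
proof -
  define \<rho> where "\<rho> = (\<lambda>n. r n * sqrt (k n * n))"
  define K where "K = (\<lambda>n. nat \<lfloor>k n\<rfloor>)"
  have pos: "eventually (\<lambda>n. 0 < n) sequentially" by (rule eventually_gt_at_top)
  have \<rho>: "\<rho> \<longlonglongrightarrow> a" using assms by (simp add: \<rho>_def)
  have inv_n: "(\<lambda>n. 1 / real n) \<longlonglongrightarrow> 0" by (rule lim_1_over_n)
  have Kk: "(\<lambda>n. K n / k n) \<longlonglongrightarrow> 1"
  proof (rule tendsto_sandwich)
    have "1 - 1 / k n \<le> K n / k n" for n
    proof -
      have "(k n - 1) / k n \<le> K n / k n"
        using floor_bounds(2)[of n] k_pos[of n] by (intro divide_right_mono) (auto simp: K_def)
      then show ?thesis using k_pos[of n] by (simp add: diff_divide_distrib)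
    qed
    then show "eventually (\<lambda>n. 1 - 1 / k n \<le> K n / k n) sequentially" by simp
    show "eventually (\<lambda>n. K n / k n \<le> 1) sequentially"
      using floor_bounds k_pos by (intro always_eventually allI) (auto simp: K_def field_simps)
    show "(\<lambda>n. 1 - 1 / k n) \<longlonglongrightarrow> 1" using tendsto_diff[OF tendsto_const k_inf, of 1] by simp
  qed simp
  have r0: "r \<longlonglongrightarrow> 0"
  proof (rule Lim_transform_eventually)
    show "(\<lambda>n. \<rho> n * sqrt (1 / k n * (1 / n))) \<longlonglongrightarrow> 0"
      using tendsto_mult[OF \<rho> tendsto_real_sqrt[OF tendsto_mult[OF k_inf inv_n]]] by simp
    show "eventually (\<lambda>n. \<rho> n * sqrt (1 / k n * (1 / n)) = r n) sequentially"
      using pos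
    proof eventually_elim
      case (elim n)
      have "sqrt (k n * n) * sqrt (1 / k n * (1 / n)) = 1"
        using elim k_pos[of n] by (simp add: real_sqrt_mult[symmetric])
      then show ?case by (simp add: \<rho>_def mult.assoc)
    qed
  qed
  have rk: "(\<lambda>n. r n * k n) \<longlonglongrightarrow> 0"
  proof (rule Lim_transform_eventually)
    show "(\<lambda>n. \<rho> n * sqrt (k n / n)) \<longlonglongrightarrow> 0"
      using tendsto_mult[OF \<rho> tendsto_real_sqrt[OF k_less]] by simp
    show "eventually (\<lambda>n. \<rho> n * sqrt (k n / n) = r n * k n) sequentially"
      using pos
    proof eventually_elim
      case (elim n)
      have "sqrt (k n * n) * sqrt (k n / n) = k n"
        using elim k_pos[of n] by (simp add: real_sqrt_mult[symmetric])
      then show ?case by (simp add: \<rho>_def mult.assoc)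
    qed
  qed
  have rK: "(\<lambda>n. r n * K n) \<longlonglongrightarrow> 0"
  proof (rule Lim_transform_eventually)
    show "(\<lambda>n. (r n * k n) * (K n / k n)) \<longlonglongrightarrow> 0"
      using tendsto_mult[OF rk Kk] by simp
  qed (use k_pos in \<open>auto simp: less_imp_neq[symmetric]\<close>)
  have r2n: "(\<lambda>n. (r n)\<^sup>2 * K n * n) \<longlonglongrightarrow> a\<^sup>2"
  proof (rule Lim_transform_eventually)
    show "(\<lambda>n. (\<rho> n)\<^sup>2 * (K n / k n)) \<longlonglongrightarrow> a\<^sup>2"
      using tendsto_mult[OF tendsto_power[OF \<rho>, of 2] Kk] by simp
    show "eventually (\<lambda>n. (\<rho> n)\<^sup>2 * (K n / k n) = (r n)\<^sup>2 * K n * n) sequentially"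
      using k_pos by (intro always_eventually allI)
        (simp add: \<rho>_def power_mult_distrib less_imp_le less_imp_neq[symmetric])
  qed
  have r2n': "(\<lambda>n. n * ((r n)\<^sup>2 * Suc (K n))) \<longlonglongrightarrow> a\<^sup>2"
  proof (rule Lim_transform_eventually)
    show "(\<lambda>n. (r n)\<^sup>2 * K n * n + (\<rho> n)\<^sup>2 * (1 / k n)) \<longlonglongrightarrow> a\<^sup>2"
      using tendsto_add[OF r2n tendsto_mult[OF tendsto_power[OF \<rho>, of 2] k_inf]] by simp
    show "eventually (\<lambda>n. (r n)\<^sup>2 * K n * n + (\<rho> n)\<^sup>2 * (1 / k n) = n * ((r n)\<^sup>2 * Suc (K n))) sequentially"
      using k_pos by (intro always_eventually allI)
        (simp add: \<rho>_def less_imp_le less_imp_neq[symmetric] algebra_simps)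
  qed
  have rK': "(\<lambda>n. Suc (K n) * r n) \<longlonglongrightarrow> 0"
    using tendsto_add[OF rK r0] by (simp add: algebra_simps)
  have r2: "(\<lambda>n. (r n)\<^sup>2 * Suc (K n)) \<longlonglongrightarrow> 0"
    using tendsto_mult[OF r0 rK'] by (simp add: power2_eq_square mult_ac)
  have "(\<lambda>n. prob_all_long dflt (r n) (K n) n) \<longlonglongrightarrow> exp (- (a\<^sup>2))"
  proof (rule tendsto_sandwich)
    have "eventually (\<lambda>n. k n / n < 1) sequentially" using order_tendstoD(2)[OF k_less, of 1] by simp
    moreover have "eventually (\<lambda>n. r n < 1) sequentially" using order_tendstoD(2)[OF r0, of 1] by simp
    moreover have "eventually (\<lambda>n. (r n)\<^sup>2 * Suc (K n) < 1) sequentially"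
      using order_tendstoD(2)[OF r2, of 1] by simp
    ultimately show "eventually (\<lambda>n. exp (- (2 * (Suc (K n) * r n) / (1 - r n) +
          n * ((r n)\<^sup>2 * Suc (K n)) / (1 - (r n)\<^sup>2 * Suc (K n))))
        \<le> prob_all_long dflt (r n) (K n) n) sequentially"
      using pos
    proof eventually_elim
      case (elim n)
      have "real (K n) < n" using elim floor_bounds(1)[of n] by (simp add: K_def field_simps)
      then show ?case using prob_all_long_lower[OF r(1)[of n] r(2)[of n], where K = "K n" and n = n and dflt = dflt] elim
        by simp
    qed
    show "(\<lambda>n. exp (- (2 * (Suc (K n) * r n) / (1 - r n) +
          n * ((r n)\<^sup>2 * Suc (K n)) / (1 - (r n)\<^sup>2 * Suc (K n))))) \<longlonglongrightarrow> exp (- (a\<^sup>2))"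
      by (rule tendsto_eq_intros rK' r0 r2 r2n' refl | simp)+
    have "prob_all_long dflt (r n) (K n) n \<le>
        exp (- ((r n)\<^sup>2 * K n * n * ((1 - r n) / (1 + 2 * (r n * K n)))))" for n
      using prob_all_long_upper[OF r(1)[of n] r(2)[of n], where K = "K n" and n = n and dflt = dflt]
      by (simp add: power2_eq_square mult_ac)
    then show "eventually (\<lambda>n. prob_all_long dflt (r n) (K n) n \<le>
        exp (- ((r n)\<^sup>2 * K n * n * ((1 - r n) / (1 + 2 * (r n * K n)))))) sequentially"
      by simp
    show "(\<lambda>n. exp (- ((r n)\<^sup>2 * K n * n * ((1 - r n) / (1 + 2 * (r n * K n)))))) \<longlonglongrightarrow> exp (- (a\<^sup>2))"
      by (rule tendsto_eq_intros rK r0 r2n refl | simp)+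
  qed
  then show ?thesis by (simp add: K_def)
qed

end

section \<open>From Landau symbols to limits\<close>

text \<open>
  The little-o relation also excludes zeros of \<open>r\<close> for large \<open>n\<close>, which the convergence to \<open>0\<close> of
  the quotient \<open>1 / (f n * r n)\<close> would not, as division by \<open>0\<close> gives \<open>0\<close>.
\<close>

lemma filterlim_at_top_of_smallo:
  fixes r f :: "nat \<Rightarrow> real"
  assumes "(\<lambda>n. 1 / f n) \<in> o(r)" "\<And>n. 0 \<le> r n" "eventually (\<lambda>n. 0 < f n) sequentially"
  shows "filterlim (\<lambda>n. r n * f n) at_top sequentially"
  unfolding filterlim_at_top_gt[where c = 0]
proof (intro allI impI)
  fix Z :: real assume "0 < Z"
  then have "eventually (\<lambda>n. norm (1 / f n) \<le> 1 / Z * norm (r n)) sequentially"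
    by (intro landau_o.smallD[OF assms(1)]) auto
  then show "eventually (\<lambda>n. Z \<le> r n * f n) sequentially"
    using assms(3)
    by eventually_elim (use \<open>0 < Z\<close> assms(2) in \<open>simp add: field_simps\<close>)
qed

lemma tendsto_of_asymp_equiv:
  fixes r f :: "nat \<Rightarrow> real"
  assumes "r \<sim>[at_top] (\<lambda>n. a / f n)" "0 < a" "eventually (\<lambda>n. 0 < f n) sequentially"
  shows "(\<lambda>n. r n * f n) \<longlonglongrightarrow> a"
proof -
  have "eventually (\<lambda>n. r n \<noteq> 0 \<or> a / f n \<noteq> 0) sequentially"
    using assms(3) by eventually_elim (use assms(2) in auto)
  from tendsto_mult_left[OF asymp_equivD_strong[OF assms(1) this], of a]
  have "(\<lambda>n. a * (r n / (a / f n))) \<longlonglongrightarrow> a" by simp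
  then show ?thesis using assms(2) by simp
qed

lemma tendsto_of_smallo: "r \<in> o(\<lambda>n. 1 / f n) \<Longrightarrow> (\<lambda>n. r n * f n) \<longlonglongrightarrow> 0"
  for r f :: "nat \<Rightarrow> real"
  using smalloD_tendsto[of r _ "\<lambda>n. 1 / f n"] by simp

section \<open>The threshold for the shortest component and the shortest gap\<close>

theorem proposition3p8:
  fixes k p q :: "nat \<Rightarrow> real" and \<alpha> :: real
  assumes p_range: "\<And>n. 0 \<le> p n \<and> p n < 1"
    and q_def: "\<And>n. q n = 1 - p n"
    and k_pos: "\<And>n. 0 < k n"
    and one_ll_k: "(\<lambda>n. 1) \<in> o(k)"
    and k_ll_n: "k \<in> o(\<lambda>n. real n)"
    and alpha_pos: "0 < \<alpha>"
  shows
    "((\<lambda>n. 1 / sqrt (k n * real n)) \<in> o(q) \<longrightarrow>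
        (\<lambda>n. measure_pmf.prob (random_composition n (p n)) {C. real (comp_min n C) > k n})
          \<longlonglongrightarrow> 0) \<and>
     (q \<sim>[at_top] (\<lambda>n. \<alpha> / sqrt (k n * real n)) \<longrightarrow>
        (\<lambda>n. measure_pmf.prob (random_composition n (p n)) {C. real (comp_min n C) > k n})
          \<sim>[at_top] (\<lambda>n. exp (- (\<alpha>^2)))) \<and>
     (q \<in> o(\<lambda>n. 1 / sqrt (k n * real n)) \<longrightarrow>
        (\<lambda>n. measure_pmf.prob (random_composition n (p n)) {C. real (comp_min n C) > k n})
          \<sim>[at_top] (\<lambda>n. 1)) \<and>
     (p \<in> o(\<lambda>n. 1 / sqrt (k n * real n)) \<longrightarrow>
        (\<lambda>n. measure_pmf.prob (random_composition n (p n)) {C. real (gap_min n C) > k n})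
          \<sim>[at_top] (\<lambda>n. 1)) \<and>
     (p \<sim>[at_top] (\<lambda>n. \<alpha> / sqrt (k n * real n)) \<longrightarrow>
        (\<lambda>n. measure_pmf.prob (random_composition n (p n)) {C. real (gap_min n C) > k n})
          \<sim>[at_top] (\<lambda>n. exp (- (\<alpha>^2)))) \<and>
     ((\<lambda>n. 1 / sqrt (k n * real n)) \<in> o(p) \<longrightarrow>
        (\<lambda>n. measure_pmf.prob (random_composition n (p n)) {C. real (gap_min n C) > k n})
          \<longlonglongrightarrow> 0)"
proof -
  have comp: "measure_pmf.prob (random_composition n (p n)) {C. real (comp_min n C) > k n} =
      prob_all_long False (q n) (nat \<lfloor>k n\<rfloor>) n" for n
    using prob_comp_min p_range k_pos by (simp add: q_def)
  have gap: "measure_pmf.prob (random_composition n (p n)) {C. real (gap_min n C) > k n} =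
      prob_all_long True (p n) (nat \<lfloor>k n\<rfloor>) n" for n
    using prob_gap_min p_range k_pos by simp
  have q: "0 \<le> q n" "q n \<le> 1" and p: "0 \<le> p n" "p n \<le> 1" for n
    using p_range[of n] by (auto simp: q_def)
  have k: "(\<lambda>n. 1 / k n) \<longlonglongrightarrow> 0" "(\<lambda>n. k n / n) \<longlonglongrightarrow> 0"
    using smalloD_tendsto[OF one_ll_k] smalloD_tendsto[OF k_ll_n] by auto
  have f: "eventually (\<lambda>n. 0 < sqrt (k n * real n)) sequentially"
    using eventually_gt_at_top[of 0] by eventually_elim (use k_pos in simp)
  note lim = prob_all_long_tendsto_0[OF _ _ k_pos k] prob_all_long_tendsto_exp[OF _ _ k_pos k]
  have exp_equiv: "g \<sim>[at_top] (\<lambda>n. exp (- (a^2)))" if "g \<longlonglongrightarrow> exp (- (a^2))"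
    for g :: "nat \<Rightarrow> real" and a :: real
    using that by (rule tendsto_imp_asymp_equiv_const) simp
  show ?thesis
    unfolding comp gap
    using lim(1)[OF q filterlim_at_top_of_smallo[OF _ q(1) f]]
      lim(1)[OF p filterlim_at_top_of_smallo[OF _ p(1) f]]
      exp_equiv[OF lim(2)[OF q tendsto_of_asymp_equiv[OF _ alpha_pos f]]]
      exp_equiv[OF lim(2)[OF p tendsto_of_asymp_equiv[OF _ alpha_pos f]]]
      exp_equiv[OF lim(2)[OF q tendsto_of_smallo]]
      exp_equiv[OF lim(2)[OF p tendsto_of_smallo]]
    by simp
qed

end
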